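(* Let $D$ be an Eulerian digraph on the vertex set $[n]=\{1,\dots,n\}$ such that for all $i,j\in[n]$ the number of edges going from vertex $i$ to vertex $j$ equals the number of edges going from vertex $j$ to vertex $i$. Then the sequence of coefficients of $P_D(t)$ is ultra log-concave.
   Context: A digraph (finite, multiple edges allowed) is Eulerian if it is connected and $\mathrm{indeg}(v)=\mathrm{outdeg}(v)$ at every vertex $v$. An oriented spanning tree rooted at $r$ is a spanning tree in which every vertex has a unique directed path to $r$. A $k$-spanning tree rooted at $r$ is a spanning tree such that reversing the orientation of exactly $k$ of its edges yields an oriented spanning tree rooted at $r$; $c_k(D,r)$ is the number of these. For Eulerian $D$, $c_k(D,r)$ is independent of $r$, and $P_D(t)=\sum_{k\ge0}c_k(D,r)t^k$. Its coefficient sequence is $a_0,\dots,a_d$ with $a_k=c_k(D,r)$ and $d=|V(D)|-1$. A sequence of nonnegative integers $a_0,\dots,a_d$ is ultra log-concave if $\dfrac{a_k^2}{\binom{d}{k}^2}\ge \dfrac{a_{k+1}}{\binom{d}{k+1}}\cdot\dfrac{a_{k-1}}{\binom{d}{k-1}}$ for all $0<k<d$. *)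

theory Defs
  imports
    "Graph_Theory.Digraph_Component"
    "HOL-Computational_Algebra.Polynomial"
begin

text \<open>
  Digraphs are those of the entry Graph\_Theory: multiple arcs and loops are allowed.
  The notion \<open>connected\<close> used below is the one of that entry (connectedness of the
  underlying undirected graph), not the topological one.
\<close>

definition eulerian :: "('a, 'b) pre_digraph \<Rightarrow> bool" where
  "eulerian G \<longleftrightarrow> fin_digraph G \<and> Digraph_Component.connected G \<and>
     (\<forall>v \<in> verts G. in_degree G v = out_degree G v)"

definition reverse_arcs :: "'b set \<Rightarrow> ('a, 'b) pre_digraph \<Rightarrow> ('a, 'b) pre_digraph" where
  "reverse_arcs S G =
     G\<lparr>tail := (\<lambda>e. if e \<in> S then head G e else tail G e),
       head := (\<lambda>e. if e \<in> S then tail G e else head G e)\<rparr>"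

text \<open>
  The notions \<open>forest\<close>, \<open>tree\<close> and \<open>spanning_tree\<close> of Graph\_Theory only forbid
  \<^emph>\<open>directed\<close> cycles, so they do not describe the trees of the underlying undirected
  multigraph. A cycle of the latter is a closed path that traverses each of its arcs either
  forwards or backwards, that is, a directed cycle once the arcs traversed backwards are
  reversed. A loop, and a pair of distinct arcs with the same two end points, are cycles;
  going back and forth along a single arc is not.
\<close>

definition undirected_cycle :: "('a, 'b) pre_digraph \<Rightarrow> 'b list \<Rightarrow> bool" where
  "undirected_cycle G p \<longleftrightarrow> (\<exists>S \<subseteq> arcs G. pre_digraph.cycle (reverse_arcs S G) p)"

definition undirected_tree :: "('a, 'b) pre_digraph \<Rightarrow> bool" where
  "undirected_tree H \<longleftrightarrow> Digraph_Component.connected H \<and> (\<nexists>p. undirected_cycle H p)"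

definition undirected_spanning_tree ::
    "('a, 'b) pre_digraph \<Rightarrow> ('a, 'b) pre_digraph \<Rightarrow> bool" where
  "undirected_spanning_tree H G \<longleftrightarrow> undirected_tree H \<and> spanning H G"

definition oriented_spanning_tree ::
    "('a, 'b) pre_digraph \<Rightarrow> 'a \<Rightarrow> ('a, 'b) pre_digraph \<Rightarrow> bool" where
  "oriented_spanning_tree G r H \<longleftrightarrow>
     undirected_spanning_tree H G \<and> r \<in> verts G \<and>
     (\<forall>v \<in> verts G. \<exists>!p. pre_digraph.apath H v p r)"

text \<open>
  The reversal is applied to \<open>G\<close> as well because a subgraph must have the same
  end point functions as the ambient digraph.
\<close>

definition k_spanning_tree ::
    "('a, 'b) pre_digraph \<Rightarrow> 'a \<Rightarrow> nat \<Rightarrow> ('a, 'b) pre_digraph \<Rightarrow> bool" where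
  "k_spanning_tree G r k H \<longleftrightarrow>
     undirected_spanning_tree H G \<and>
     (\<exists>S \<subseteq> arcs H. card S = k \<and>
        oriented_spanning_tree (reverse_arcs S G) r (reverse_arcs S H))"

definition num_k_spanning_trees :: "('a, 'b) pre_digraph \<Rightarrow> 'a \<Rightarrow> nat \<Rightarrow> nat" where
  "num_k_spanning_trees G r k = card {H. k_spanning_tree G r k H}"

text \<open>
  The sum over all \<open>k\<close> is cut off at the number of arcs, beyond which there are no
  \<open>k\<close>-spanning trees; the lemma \<open>coeff_spanning_tree_poly\<close> shows that nothing is lost.
\<close>

definition spanning_tree_poly :: "('a, 'b) pre_digraph \<Rightarrow> 'a \<Rightarrow> nat poly" where
  "spanning_tree_poly G r =
     (\<Sum>k\<le>card (arcs G). monom (num_k_spanning_trees G r k) k)"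

lemma coeff_spanning_tree_poly:
  assumes "fin_digraph G"
  shows "coeff (spanning_tree_poly G r) k = num_k_spanning_trees G r k"
proof -
  have "num_k_spanning_trees G r k = 0" if "card (arcs G) < k"
  proof -
    have "\<not> k_spanning_tree G r k H" for H
    proof
      assume "k_spanning_tree G r k H"
      then obtain S where "S \<subseteq> arcs G" "card S = k"
        unfolding k_spanning_tree_def undirected_spanning_tree_def spanning_def subgraph_def
        by blast
      with that show False
        using card_mono[OF fin_digraph.finite_arcs[OF assms], of S] by simp
    qed
    then show ?thesis by (simp add: num_k_spanning_trees_def)
  qed
  then show ?thesis
    by (cases "k \<le> card (arcs G)") (simp_all add: spanning_tree_poly_def coeff_sum)
qed

definition ultra_log_concave :: "nat \<Rightarrow> (nat \<Rightarrow> nat) \<Rightarrow> bool" where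
  "ultra_log_concave d a \<longleftrightarrow>
     (\<forall>k. 0 < k \<and> k < d \<longrightarrow>
        (real (a k))\<^sup>2 / (real (d choose k))\<^sup>2 \<ge>
        real (a (k + 1)) / real (d choose (k + 1)) * (real (a (k - 1)) / real (d choose (k - 1))))"

end

theory Submission
  imports Defs
begin

text \<open>
  For a digraph with as many arcs from \<open>i\<close> to \<open>j\<close> as from \<open>j\<close> to \<open>i\<close>, the polynomial is
  \<open>c (1 + t)\<^sup>d\<close>, where \<open>c\<close> is the number of oriented spanning trees rooted at \<open>r\<close>. So
  \<open>a\<^sub>k = c (d choose k)\<close>, and ultra log-concavity holds with equality.

  The factorization has a bijective proof. The symmetry of the arc counts provides an
  involution \<open>\<sigma>\<close> of the arcs that exchanges the end points of every arc
  (\<open>arc_reversal_exists\<close>). If \<open>T\<close> is the arc set of a tree that becomes oriented towards \<open>r\<close>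
  when the \<open>k\<close> arcs of \<open>S \<subseteq> T\<close> are reversed, then instead of reversing the arcs of \<open>S\<close> one
  can replace them by their \<open>\<sigma>\<close>-partners. This yields an oriented spanning tree
  \<open>T\<^sub>0 = (T - S) \<union> \<sigma> ` S\<close> of the same digraph with a marked set \<open>\<sigma> ` S\<close> of \<open>k\<close> arcs, and
  replacing the marked arcs leads back to \<open>T\<close>. The correspondence is one-to-one because the
  set \<open>S\<close> is determined by \<open>T\<close> (\<open>reversed_arcs_unique\<close>). Since \<open>T\<^sub>0\<close> has exactly
  \<open>d\<close> arcs (\<open>card_arcs_in_arborescence\<close>), each \<open>T\<^sub>0\<close> has \<open>d choose k\<close> markings.
\<close>

section \<open>Reversing arcs\<close>

lemma reverse_arcs_simps [simp]:
  "verts (reverse_arcs S D) = verts D"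
  "arcs (reverse_arcs S D) = arcs D"
  "tail (reverse_arcs S D) e = (if e \<in> S then head D e else tail D e)"
  "head (reverse_arcs S D) e = (if e \<in> S then tail D e else head D e)"
  by (simp_all add: reverse_arcs_def)

lemma reverse_arcs_empty [simp]: "reverse_arcs {} D = D"
  by (simp add: reverse_arcs_def)

lemma reverse_arcs_reverse_arcs:
  "reverse_arcs S (reverse_arcs R D) = reverse_arcs ((S - R) \<union> (R - S)) D"
  by (auto simp: reverse_arcs_def fun_eq_iff)

lemma wf_digraph_reverse_arcs: "wf_digraph D \<Longrightarrow> wf_digraph (reverse_arcs S D)"
  by (auto simp: wf_digraph_def)

lemma wf_digraph_restrict_arcs: "wf_digraph D \<Longrightarrow> T \<subseteq> arcs D \<Longrightarrow> wf_digraph (D\<lparr>arcs := T\<rparr>)"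
  by (auto simp: wf_digraph_def)

lemma undirected_tree_reverse_arcs:
  assumes "R \<subseteq> arcs D" "undirected_tree D"
  shows "undirected_tree (reverse_arcs R D)"
proof -
  have "mk_symmetric (reverse_arcs R D) = mk_symmetric D"
    by (auto simp: mk_symmetric_def split: if_splits)
  moreover have "undirected_cycle D p" if "undirected_cycle (reverse_arcs R D) p" for p
  proof -
    from that obtain S where "S \<subseteq> arcs D" "pre_digraph.cycle (reverse_arcs S (reverse_arcs R D)) p"
      by (auto simp: undirected_cycle_def)
    with assms(1) show ?thesis
      unfolding undirected_cycle_def reverse_arcs_reverse_arcs
      by (intro exI[of _ "(S - R) \<union> (R - S)"]) auto
  qed
  ultimately show ?thesis
    using assms(2) by (auto simp: undirected_tree_def Digraph_Component.connected_def)
qed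

lemma undirected_tree_reverse_arcs_iff:
  assumes "R \<subseteq> arcs D"
  shows "undirected_tree (reverse_arcs R D) \<longleftrightarrow> undirected_tree D"
  using undirected_tree_reverse_arcs[of R D] undirected_tree_reverse_arcs[of R "reverse_arcs R D"]
    assms
  by (auto simp: reverse_arcs_reverse_arcs)

lemma undirected_tree_awalk_closed:
  assumes "wf_digraph D" "undirected_tree D" "pre_digraph.awalk D u p u"
  shows "p = []"
proof (rule ccontr)
  interpret wf_digraph D by fact
  assume "p \<noteq> []"
  with assms(3) have "closed_w p" by (auto simp: closed_w_def)
  then obtain q where "cycle q" using closed_w_imp_cycle by blast
  then have "undirected_cycle D q"
    unfolding undirected_cycle_def by (intro exI[of _ "{}"]) simp
  with assms(2) show False by (auto simp: undirected_tree_def)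
qed

section \<open>Trees oriented towards a root\<close>

text \<open>
  This is the notion of an oriented spanning tree without the ambient digraph, so that it can
  be moved along relabellings of arcs that leave the ambient digraph.
\<close>

definition in_arborescence :: "('a, 'b) pre_digraph \<Rightarrow> 'a \<Rightarrow> bool" where
  "in_arborescence D r \<longleftrightarrow> undirected_tree D \<and> r \<in> verts D \<and>
     (\<forall>v \<in> verts D. \<exists>!p. pre_digraph.apath D v p r)"

lemma in_arborescence_awalk:
  assumes "in_arborescence D r" "v \<in> verts D"
  obtains p where "pre_digraph.awalk D v p r"
  using assms unfolding in_arborescence_def by (meson pre_digraph.awalkI_apath)

lemma in_arborescence_no_arc_from_root:
  assumes "wf_digraph D" "in_arborescence D r" "e \<in> arcs D"
  shows "tail D e \<noteq> r"
proof
  interpret wf_digraph D by fact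
  assume "tail D e = r"
  moreover obtain p where "awalk (head D e) p r"
    using in_arborescence_awalk[OF assms(2)] assms(3) head_in_verts by blast
  ultimately have "awalk r (e # p) r"
    using assms(3) by (auto simp: awalk_Cons_iff)
  then show False
    using undirected_tree_awalk_closed[OF assms(1)] assms(2) by (auto simp: in_arborescence_def)
qed

text \<open>
  Two arcs leaving the same vertex would start two different paths to the root: a walk
  that is not a path would contain a closed walk, which a tree excludes.
\<close>

lemma in_arborescence_tail_inj:
  assumes "wf_digraph D" "in_arborescence D r"
  shows "inj_on (tail D) (arcs D)"
proof (rule inj_onI)
  interpret wf_digraph D by fact
  have acyclic: "p = []" if "awalk u p u" for u p
    using undirected_tree_awalk_closed[OF assms(1)] assms(2) that
    by (auto simp: in_arborescence_def)
  have path_via: "\<exists>p. apath (tail D e) (e # p) r" if e: "e \<in> arcs D" for e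
  proof -
    obtain p where "awalk (head D e) p r"
      using in_arborescence_awalk[OF assms(2)] e head_in_verts by blast
    with e have w: "awalk (tail D e) (e # p) r" by (simp add: awalk_Cons_iff)
    have "distinct (awalk_verts (tail D e) (e # p))"
    proof (rule ccontr)
      assume "\<not> ?thesis"
      from awalk_not_distinct_decomp[OF w this] show False using acyclic by blast
    qed
    with w show ?thesis by (auto simp: apath_def)
  qed
  fix e f assume "e \<in> arcs D" "f \<in> arcs D" and eq: "tail D e = tail D f"
  then obtain p q where "apath (tail D e) (e # p) r" "apath (tail D e) (f # q) r"
    using path_via by metis
  moreover have "\<exists>!p. apath (tail D e) p r"
    using assms(2) \<open>e \<in> arcs D\<close> tail_in_verts by (auto simp: in_arborescence_def)
  ultimately show "e = f" by blast
qed

text \<open>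
  Every vertex except the root has exactly one outgoing arc.
\<close>

lemma card_arcs_in_arborescence:
  assumes "wf_digraph D" "in_arborescence D r"
  shows "card (arcs D) = card (verts D) - 1"
proof -
  interpret wf_digraph D by fact
  have "tail D ` arcs D = verts D - {r}"
  proof (intro equalityI subsetI)
    fix v assume "v \<in> tail D ` arcs D"
    then show "v \<in> verts D - {r}"
      using in_arborescence_no_arc_from_root[OF assms] tail_in_verts by auto
  next
    fix v assume v: "v \<in> verts D - {r}"
    then obtain p where "awalk v p r" using in_arborescence_awalk[OF assms(2)] by blast
    with v show "v \<in> tail D ` arcs D" by (cases p) (auto simp: awalk_simps)
  qed
  then have "card (arcs D) = card (verts D - {r})"
    using card_image[OF in_arborescence_tail_inj[OF assms]] by simp
  also have "\<dots> = card (verts D) - 1"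
    using assms(2) by (simp add: in_arborescence_def)
  finally show ?thesis .
qed

text \<open>
  An underlying tree has only one orientation towards the root. Suppose that two orientations
  differ on an arc that the first directs into \<open>v\<close>. The second directs this arc out of \<open>v\<close>,
  so \<open>v\<close> is not the root and has no other outgoing arc in the second orientation. Hence the
  arc that leaves \<open>v\<close> in the first orientation is another arc on which the two differ. In this
  way the difference propagates along the path of the first orientation from \<open>v\<close> to
  the root, which is impossible.
\<close>

lemma reversed_arcs_unique:
  assumes wf: "wf_digraph H"
    and S: "S \<subseteq> arcs H" "in_arborescence (reverse_arcs S H) r"
    and S': "S' \<subseteq> arcs H" "in_arborescence (reverse_arcs S' H) r"
  shows "S = S'"
proof -
  let ?D = "reverse_arcs S H" and ?D' = "reverse_arcs S' H"
  interpret D: wf_digraph ?D using wf by (rule wf_digraph_reverse_arcs)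
  have wf': "wf_digraph ?D'" using wf by (rule wf_digraph_reverse_arcs)
  have differ: "head ?D e \<noteq> v"
    if "D.awalk v p r" "e \<in> arcs H" "e \<in> S \<longleftrightarrow> e \<notin> S'" for v p e
    using that
  proof (induction p arbitrary: v e)
    case Nil
    then have "v = r" by (simp add: D.awalk_simps)
    moreover have "tail ?D' e \<noteq> r"
      using in_arborescence_no_arc_from_root[OF wf' S'(2)] Nil.prems(2) by simp
    ultimately show ?case using Nil.prems(3) by auto
  next
    case (Cons f p)
    show ?case
    proof
      assume e: "head ?D e = v"
      from Cons.prems(1) have f: "f \<in> arcs H" "tail ?D f = v" "D.awalk (head ?D f) p r"
        unfolding D.awalk_Cons_iff by auto
      show False
      proof (cases "f \<in> S \<longleftrightarrow> f \<in> S'")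
        case True
        then have "tail ?D' f = tail ?D' e"
          using f(2) e Cons.prems(3) by auto
        then have "f = e"
          by (rule inj_onD[OF in_arborescence_tail_inj[OF wf' S'(2)]])
             (use f(1) Cons.prems(2) in simp_all)
        with True Cons.prems(3) show False by simp
      next
        case False
        with Cons.IH[OF f(3) f(1)] show False by blast
      qed
    qed
  qed
  have "e \<in> S \<longleftrightarrow> e \<in> S'" if e: "e \<in> arcs H" for e
  proof -
    have "head ?D e \<in> verts ?D" using D.head_in_verts e by simp
    then obtain p where "D.awalk (head ?D e) p r" using in_arborescence_awalk[OF S(2)] by blast
    from differ[OF this e] show ?thesis by blast
  qed
  with S(1) S'(1) show ?thesis by blast
qed

section \<open>Relabelling arcs\<close>

definition relabels :: "('b \<Rightarrow> 'c) \<Rightarrow> ('a, 'b) pre_digraph \<Rightarrow> ('a, 'c) pre_digraph \<Rightarrow> bool" where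
  "relabels \<phi> D D' \<longleftrightarrow> inj_on \<phi> (arcs D) \<and> verts D' = verts D \<and> arcs D' = \<phi> ` arcs D \<and>
     (\<forall>e \<in> arcs D. tail D' (\<phi> e) = tail D e \<and> head D' (\<phi> e) = head D e)"

lemma relabels_inv_into:
  assumes "relabels \<phi> D D'"
  shows "relabels (inv_into (arcs D) \<phi>) D' D"
  using assms by (auto simp: relabels_def inj_on_inv_into inv_into_f_f)

lemma relabels_reverse_arcs:
  assumes "relabels \<phi> D D'" "S \<subseteq> arcs D"
  shows "relabels \<phi> (reverse_arcs S D) (reverse_arcs (\<phi> ` S) D')"
proof -
  have "\<phi> e \<in> \<phi> ` S \<longleftrightarrow> e \<in> S" if "e \<in> arcs D" for e
    using assms that by (intro inj_on_image_mem_iff) (auto simp: relabels_def)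
  with assms(1) show ?thesis by (simp add: relabels_def)
qed

lemma relabels_awalk_verts:
  assumes "relabels \<phi> D D'" "set p \<subseteq> arcs D"
  shows "pre_digraph.awalk_verts D' u (map \<phi> p) = pre_digraph.awalk_verts D u p"
  using assms(2)
  by (induction p arbitrary: u)
     (use assms(1) in \<open>auto simp: relabels_def pre_digraph.awalk_verts.simps\<close>)

lemma relabels_awalk:
  assumes "relabels \<phi> D D'" "pre_digraph.awalk D u p v"
  shows "pre_digraph.awalk D' u (map \<phi> p) v"
proof -
  have "pre_digraph.cas D' u (map \<phi> p) v" if "set p \<subseteq> arcs D" "pre_digraph.cas D u p v"
    using that
    by (induction p arbitrary: u)
       (use assms(1) in \<open>auto simp: relabels_def pre_digraph.cas.simps\<close>)
  with assms show ?thesis by (auto simp: pre_digraph.awalk_def relabels_def)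
qed

lemma relabels_cycle:
  assumes "relabels \<phi> D D'" "pre_digraph.cycle D p"
  shows "pre_digraph.cycle D' (map \<phi> p)"
proof -
  from assms(2) obtain u where u: "pre_digraph.awalk D u p u"
      "distinct (tl (pre_digraph.awalk_verts D u p))" "p \<noteq> []"
    by (auto simp: pre_digraph.cycle_def)
  then have "set p \<subseteq> arcs D" by (auto simp: pre_digraph.awalk_def)
  with u show ?thesis
    using relabels_awalk[OF assms(1) u(1)]
    by (auto simp: pre_digraph.cycle_def relabels_awalk_verts[OF assms(1)])
qed

lemma relabels_apath:
  assumes "relabels \<phi> D D'" "pre_digraph.apath D u p v"
  shows "pre_digraph.apath D' u (map \<phi> p) v"
proof -
  from assms(2) have "set p \<subseteq> arcs D" by (auto simp: pre_digraph.apath_def pre_digraph.awalk_def)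
  with assms show ?thesis
    by (simp add: pre_digraph.apath_def relabels_awalk relabels_awalk_verts)
qed

lemma relabels_undirected_tree:
  assumes rel: "relabels \<phi> D D'" and tree: "undirected_tree D"
  shows "undirected_tree D'"
proof -
  have "mk_symmetric D' = mk_symmetric D"
    using rel by (auto simp: mk_symmetric_def relabels_def)
  then have "Digraph_Component.connected D'"
    using tree by (simp add: undirected_tree_def Digraph_Component.connected_def)
  moreover have False if "undirected_cycle D' p" for p
  proof -
    let ?\<psi> = "inv_into (arcs D) \<phi>"
    from that obtain S where S: "S \<subseteq> arcs D'" "pre_digraph.cycle (reverse_arcs S D') p"
      by (auto simp: undirected_cycle_def)
    have inv: "relabels ?\<psi> D' D" using rel by (rule relabels_inv_into)
    have "pre_digraph.cycle (reverse_arcs (?\<psi> ` S) D) (map ?\<psi> p)"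
      using relabels_cycle[OF relabels_reverse_arcs[OF inv S(1)] S(2)] .
    moreover have "?\<psi> ` S \<subseteq> arcs D" using inv S(1) by (auto simp: relabels_def)
    ultimately have "undirected_cycle D (map ?\<psi> p)" by (auto simp: undirected_cycle_def)
    with tree show False by (auto simp: undirected_tree_def)
  qed
  ultimately show ?thesis by (auto simp: undirected_tree_def)
qed

lemma relabels_in_arborescence:
  assumes rel: "relabels \<phi> D D'" and arb: "in_arborescence D r"
  shows "in_arborescence D' r"
proof -
  let ?\<psi> = "inv_into (arcs D) \<phi>"
  have inv: "relabels ?\<psi> D' D" using rel by (rule relabels_inv_into)
  have V: "verts D' = verts D" using rel by (simp add: relabels_def)
  have "\<exists>!q. pre_digraph.apath D' v q r" if v: "v \<in> verts D'" for v
  proof -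
    obtain p where p: "pre_digraph.apath D v p r" and
        uniq: "\<And>p'. pre_digraph.apath D v p' r \<Longrightarrow> p' = p"
      using arb v V unfolding in_arborescence_def by metis
    have "q = map \<phi> p" if q: "pre_digraph.apath D' v q r" for q
    proof -
      have "set q \<subseteq> \<phi> ` arcs D"
        using q rel by (auto simp: pre_digraph.apath_def pre_digraph.awalk_def relabels_def)
      then have "map \<phi> (map ?\<psi> q) = q"
        by (auto simp: f_inv_into_f subset_iff intro!: map_idI)
      with uniq[OF relabels_apath[OF inv q]] show ?thesis by simp
    qed
    with relabels_apath[OF rel p] show ?thesis by blast
  qed
  with relabels_undirected_tree[OF rel] arb V show ?thesis
    by (auto simp: in_arborescence_def)
qed

section \<open>Replacing arcs by their reversals\<close>

definition arc_reversal :: "('a, 'b) pre_digraph \<Rightarrow> ('b \<Rightarrow> 'b) \<Rightarrow> bool" where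
  "arc_reversal G \<sigma> \<longleftrightarrow> (\<forall>e \<in> arcs G. \<sigma> e \<in> arcs G \<and> \<sigma> (\<sigma> e) = e \<and>
     tail G (\<sigma> e) = head G e \<and> head G (\<sigma> e) = tail G e)"

text \<open>
  For \<open>i < j\<close> choose a bijection from the arcs \<open>i \<rightarrow> j\<close> to the arcs \<open>j \<rightarrow> i\<close>; the
  linear order decides in which direction it is used. Loops are fixed.
\<close>

lemma arc_reversal_exists:
  fixes G :: "('a::linorder, 'b) pre_digraph"
  assumes "fin_digraph G"
    and sym: "\<And>i j. i \<in> verts G \<Longrightarrow> j \<in> verts G \<Longrightarrow>
           card {e \<in> arcs G. tail G e = i \<and> head G e = j} =
           card {e \<in> arcs G. tail G e = j \<and> head G e = i}"
  shows "\<exists>\<sigma>. arc_reversal G \<sigma>"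
proof -
  interpret fin_digraph G by fact
  let ?A = "\<lambda>i j. {e \<in> arcs G. tail G e = i \<and> head G e = j}"
  have "\<exists>f. bij_betw f (?A i j) (?A j i)" for i j
  proof (cases "i \<in> verts G \<and> j \<in> verts G")
    case True
    then show ?thesis using sym finite_arcs by (intro finite_same_card_bij) auto
  next
    case False
    then have "?A i j = {}" "?A j i = {}" using wellformed by auto
    then show ?thesis by (simp only:) (simp add: bij_betw_def)
  qed
  then have "\<forall>i. \<exists>f. \<forall>j. bij_betw (f j) (?A i j) (?A j i)" by (intro allI choice)
  from choice[OF this]
  obtain f where f: "\<And>i j. bij_betw (f i j) (?A i j) (?A j i)" by blast
  define \<sigma> where "\<sigma> e =
    (if tail G e < head G e then f (tail G e) (head G e) e
     else if head G e < tail G e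
       then inv_into (?A (head G e) (tail G e)) (f (head G e) (tail G e)) e
     else e)" for e
  have "\<sigma> e \<in> arcs G \<and> \<sigma> (\<sigma> e) = e \<and> tail G (\<sigma> e) = head G e \<and> head G (\<sigma> e) = tail G e"
    if e: "e \<in> arcs G" for e
  proof -
    define i j where ij: "i = tail G e" "j = head G e"
    consider "i < j" | "j < i" | "i = j" by fastforce
    then show ?thesis
    proof cases
      case 1
      have eA: "e \<in> ?A i j" using e ij by simp
      have s: "\<sigma> e = f i j e" using 1 by (simp add: \<sigma>_def ij)
      have sA: "\<sigma> e \<in> ?A j i" unfolding s using bij_betwE[OF f] eA by blast
      then have "\<sigma> (\<sigma> e) = inv_into (?A i j) (f i j) (\<sigma> e)"
        using 1 less_not_sym[OF 1] by (simp add: \<sigma>_def[of "\<sigma> e"])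
      also have "\<dots> = e" unfolding s using bij_betw_inv_into_left[OF f eA] .
      finally show ?thesis using sA ij by simp
    next
      case 2
      have eA: "e \<in> ?A i j" using e ij by simp
      have s: "\<sigma> e = inv_into (?A j i) (f j i) e"
        using 2 less_not_sym[OF 2] by (simp add: \<sigma>_def ij)
      have sA: "\<sigma> e \<in> ?A j i"
        unfolding s using bij_betwE[OF bij_betw_inv_into[OF f]] eA by blast
      then have "\<sigma> (\<sigma> e) = f j i (\<sigma> e)"
        using 2 by (simp add: \<sigma>_def[of "\<sigma> e"])
      also have "\<dots> = e" unfolding s using bij_betw_inv_into_right[OF f eA] .
      finally show ?thesis using sA ij by simp
    next
      case 3
      then have "\<sigma> e = e" by (simp add: \<sigma>_def ij)
      with 3 e ij show ?thesis by simp
    qed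
  qed
  then show ?thesis by (auto simp: arc_reversal_def)
qed

definition replace_arcs :: "('b \<Rightarrow> 'b) \<Rightarrow> 'b set \<Rightarrow> 'b set \<Rightarrow> 'b set" where
  "replace_arcs \<sigma> S T = (T - S) \<union> \<sigma> ` S"

text \<open>
  A tree contains neither a loop nor two arcs with the same end points, so the partner of
  an arc of a tree lies outside the tree.
\<close>

lemma arc_reversal_notin_tree:
  assumes wf: "wf_digraph G" and \<sigma>: "arc_reversal G \<sigma>" and T: "T \<subseteq> arcs G"
    and tree: "undirected_tree (G\<lparr>arcs := T\<rparr>)" and e: "e \<in> T"
  shows "\<sigma> e \<notin> T"
proof
  let ?H = "G\<lparr>arcs := T\<rparr>"
  interpret H: wf_digraph ?H using wf T by (rule wf_digraph_restrict_arcs)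
  assume "\<sigma> e \<in> T"
  moreover have "tail ?H (\<sigma> e) = head ?H e" "head ?H (\<sigma> e) = tail ?H e"
    using \<sigma> e T by (auto simp: arc_reversal_def)
  ultimately have "H.awalk (tail ?H e) [e, \<sigma> e] (tail ?H e)"
    using e H.tail_in_verts[of e] by (auto simp: H.awalk_simps)
  from undirected_tree_awalk_closed[OF H.wf_digraph_axioms tree this] show False by simp
qed

text \<open>
  Reversing an arc and replacing it by its partner have the same effect on the tree, up to
  the name of the arc. No name is used twice, since the partners are new to the tree.
\<close>

lemma replace_arcs_relabels:
  assumes wf: "wf_digraph G" and \<sigma>: "arc_reversal G \<sigma>" and T: "T \<subseteq> arcs G"
    and tree: "undirected_tree (G\<lparr>arcs := T\<rparr>)" and S: "S \<subseteq> T"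
  shows "relabels (\<lambda>e. if e \<in> S then \<sigma> e else e)
           (reverse_arcs S (G\<lparr>arcs := T\<rparr>)) (G\<lparr>arcs := replace_arcs \<sigma> S T\<rparr>)"
    (is "relabels ?\<phi> _ _")
proof -
  have out: "\<sigma> e \<notin> T" if "e \<in> T" for e
    using arc_reversal_notin_tree[OF wf \<sigma> T tree that] .
  have "inj_on \<sigma> T"
    by (rule inj_on_inverseI[of _ \<sigma>]) (use \<sigma> T in \<open>auto simp: arc_reversal_def\<close>)
  then have "inj_on ?\<phi> T"
    using out S unfolding inj_on_def by (metis subsetD)
  moreover have "?\<phi> ` T = replace_arcs \<sigma> S T"
    using S by (auto simp: replace_arcs_def)
  ultimately show ?thesis
    using \<sigma> T by (auto simp: relabels_def arc_reversal_def)
qed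

lemma replace_arcs_properties:
  assumes wf: "wf_digraph G" and \<sigma>: "arc_reversal G \<sigma>" and T: "T \<subseteq> arcs G"
    and tree: "undirected_tree (G\<lparr>arcs := T\<rparr>)" and S: "S \<subseteq> T"
  shows "replace_arcs \<sigma> S T \<subseteq> arcs G" and "\<sigma> ` S \<subseteq> replace_arcs \<sigma> S T"
    and "card (\<sigma> ` S) = card S" and "\<sigma> ` \<sigma> ` S = S"
    and "replace_arcs \<sigma> (\<sigma> ` S) (replace_arcs \<sigma> S T) = T"
proof -
  have out: "\<sigma> e \<notin> T" if "e \<in> T" for e
    using arc_reversal_notin_tree[OF wf \<sigma> T tree that] .
  have inv: "\<sigma> (\<sigma> e) = e" if "e \<in> S" for e
    using \<sigma> T S that by (auto simp: arc_reversal_def)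
  show "replace_arcs \<sigma> S T \<subseteq> arcs G"
    using \<sigma> T S by (auto simp: replace_arcs_def arc_reversal_def)
  show "\<sigma> ` S \<subseteq> replace_arcs \<sigma> S T" by (simp add: replace_arcs_def)
  show "card (\<sigma> ` S) = card S"
    by (rule card_image, rule inj_on_inverseI[of _ \<sigma>]) (rule inv)
  show inv': "\<sigma> ` \<sigma> ` S = S" using inv by (force simp: image_image)
  have "\<sigma> ` S \<inter> T = {}" using out S by auto
  then show "replace_arcs \<sigma> (\<sigma> ` S) (replace_arcs \<sigma> S T) = T"
    using S unfolding replace_arcs_def inv' by auto
qed

lemma in_arborescence_replace_arcs:
  assumes wf: "wf_digraph G" and \<sigma>: "arc_reversal G \<sigma>" and T: "T \<subseteq> arcs G" and S: "S \<subseteq> T"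
    and arb: "in_arborescence (reverse_arcs S (G\<lparr>arcs := T\<rparr>)) r"
  shows "in_arborescence (G\<lparr>arcs := replace_arcs \<sigma> S T\<rparr>) r"
proof -
  have "undirected_tree (G\<lparr>arcs := T\<rparr>)"
    using arb S by (simp add: in_arborescence_def undirected_tree_reverse_arcs_iff)
  from relabels_in_arborescence[OF replace_arcs_relabels[OF wf \<sigma> T this S] arb] show ?thesis .
qed

text \<open>
  Here the oriented tree \<open>T\<close> is given, and the arcs of \<open>S\<close> are replaced by partners that
  point the wrong way. Reversing these partners once more restores \<open>T\<close> up to the names of
  the arcs: reverse \<open>S\<close> on both sides of the relabelling, so that the two reversals of \<open>S\<close>
  in \<open>T\<close> cancel.
\<close>

lemma in_arborescence_reverse_replace_arcs:
  assumes wf: "wf_digraph G" and \<sigma>: "arc_reversal G \<sigma>" and T: "T \<subseteq> arcs G" and S: "S \<subseteq> T"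
    and arb: "in_arborescence (G\<lparr>arcs := T\<rparr>) r"
  shows "in_arborescence (reverse_arcs (\<sigma> ` S) (G\<lparr>arcs := replace_arcs \<sigma> S T\<rparr>)) r"
proof -
  let ?\<phi> = "\<lambda>e. if e \<in> S then \<sigma> e else e" and ?D = "reverse_arcs S (G\<lparr>arcs := T\<rparr>)"
  have "undirected_tree (G\<lparr>arcs := T\<rparr>)" using arb by (simp add: in_arborescence_def)
  from replace_arcs_relabels[OF wf \<sigma> T this S]
  have "relabels ?\<phi> (reverse_arcs S ?D)
      (reverse_arcs (?\<phi> ` S) (G\<lparr>arcs := replace_arcs \<sigma> S T\<rparr>))"
    by (rule relabels_reverse_arcs) (use S in simp)
  moreover have "reverse_arcs S ?D = G\<lparr>arcs := T\<rparr>" by (simp add: reverse_arcs_reverse_arcs)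
  moreover have "?\<phi> ` S = \<sigma> ` S" by auto
  ultimately have "relabels ?\<phi> (G\<lparr>arcs := T\<rparr>)
      (reverse_arcs (\<sigma> ` S) (G\<lparr>arcs := replace_arcs \<sigma> S T\<rparr>))"
    by simp
  then show ?thesis using arb by (rule relabels_in_arborescence)
qed

section \<open>Counting\<close>

lemma spanning_iff_restrict_arcs:
  assumes "wf_digraph G"
  shows "spanning H G \<longleftrightarrow> (\<exists>T \<subseteq> arcs G. H = G\<lparr>arcs := T\<rparr>)"
proof
  assume "spanning H G"
  then have "H = G\<lparr>arcs := arcs H\<rparr>" "arcs H \<subseteq> arcs G"
    by (auto simp: spanning_def subgraph_def compatible_def)
  then show "\<exists>T \<subseteq> arcs G. H = G\<lparr>arcs := T\<rparr>" by blast
next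
  assume "\<exists>T \<subseteq> arcs G. H = G\<lparr>arcs := T\<rparr>"
  with assms show "spanning H G"
    by (auto simp: spanning_def subgraph_def compatible_def wf_digraph_restrict_arcs)
qed

lemma k_spanning_tree_iff:
  assumes wf: "wf_digraph G"
  shows "k_spanning_tree G r k H \<longleftrightarrow> (\<exists>T \<subseteq> arcs G. H = G\<lparr>arcs := T\<rparr> \<and>
     (\<exists>S \<subseteq> T. card S = k \<and> in_arborescence (reverse_arcs S (G\<lparr>arcs := T\<rparr>)) r))"
    (is "?L \<longleftrightarrow> ?R")
proof
  assume L: ?L
  then have "spanning H G" by (simp add: k_spanning_tree_def undirected_spanning_tree_def)
  then obtain T where T: "T \<subseteq> arcs G" "H = G\<lparr>arcs := T\<rparr>"
    unfolding spanning_iff_restrict_arcs[OF wf] by blast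
  from L obtain S where S: "S \<subseteq> arcs H" "card S = k"
      "oriented_spanning_tree (reverse_arcs S G) r (reverse_arcs S H)"
    by (auto simp: k_spanning_tree_def)
  then have "in_arborescence (reverse_arcs S H) r"
    using T(2) unfolding oriented_spanning_tree_def undirected_spanning_tree_def in_arborescence_def
    by simp
  with T S(1,2) show ?R by auto
next
  assume ?R
  then obtain T S where TS: "T \<subseteq> arcs G" "H = G\<lparr>arcs := T\<rparr>" "S \<subseteq> T" "card S = k"
      "in_arborescence (reverse_arcs S (G\<lparr>arcs := T\<rparr>)) r"
    by blast
  have "reverse_arcs S H = (reverse_arcs S G)\<lparr>arcs := T\<rparr>"
    unfolding TS(2) by (cases G) (simp add: reverse_arcs_def fun_eq_iff)
  then have "spanning (reverse_arcs S H) (reverse_arcs S G)"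
    using TS(1) by (subst spanning_iff_restrict_arcs) (auto intro: wf_digraph_reverse_arcs wf)
  moreover have "spanning H G" using TS(1,2) spanning_iff_restrict_arcs[OF wf] by blast
  moreover have "undirected_tree H"
    using TS by (simp add: in_arborescence_def undirected_tree_reverse_arcs_iff)
  ultimately show ?L
    using TS(2-5)
    unfolding k_spanning_tree_def oriented_spanning_tree_def undirected_spanning_tree_def
      in_arborescence_def
    by (intro conjI exI[of _ S]) simp_all
qed

text \<open>
  Both factors come from the bijection \<open>\<Phi>\<close>, which sends an oriented spanning tree with a
  marked set of \<open>k\<close> arcs to the \<open>k\<close>-spanning tree in which the marked arcs are replaced by
  their partners. The second factor is the number of markings of one tree.
\<close>

lemma num_k_spanning_trees_eq:
  assumes fin: "fin_digraph G" and \<sigma>: "arc_reversal G \<sigma>"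
  shows "num_k_spanning_trees G r k =
     card {T. T \<subseteq> arcs G \<and> in_arborescence (G\<lparr>arcs := T\<rparr>) r} * (card (verts G) - 1 choose k)"
proof -
  interpret fin_digraph G by fact
  let ?G = "\<lambda>T. G\<lparr>arcs := T\<rparr>"
  define A where "A = {T. T \<subseteq> arcs G \<and> in_arborescence (?G T) r}"
  define B where "B = {T. T \<subseteq> arcs G \<and>
    (\<exists>S \<subseteq> T. card S = k \<and> in_arborescence (reverse_arcs S (?G T)) r)}"
  define M where "M = (SIGMA T:A. {S. S \<subseteq> T \<and> card S = k})"
  define \<Phi> where "\<Phi> = (\<lambda>(T, S). replace_arcs \<sigma> S T)"
  have sub: "T \<subseteq> arcs G" "S \<subseteq> T" "in_arborescence (?G T) r" "undirected_tree (?G T)" "card S = k"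
    if "(T, S) \<in> M" for T S
    using that by (auto simp: M_def A_def in_arborescence_def)
  have "bij_betw \<Phi> M B"
  proof (rule bij_betw_imageI)
    show "inj_on \<Phi> M"
    proof (rule inj_onI, clarify)
      fix T S T' S' assume m: "(T, S) \<in> M" "(T', S') \<in> M" and "\<Phi> (T, S) = \<Phi> (T', S')"
      then have eq: "replace_arcs \<sigma> S T = replace_arcs \<sigma> S' T'" (is "?U = _")
        by (simp add: \<Phi>_def)
      note s = sub[OF m(1)] and s' = sub[OF m(2)]
      note p = replace_arcs_properties[OF wf_digraph_axioms \<sigma> s(1) s(4) s(2)]
      note p' = replace_arcs_properties[OF wf_digraph_axioms \<sigma> s'(1) s'(4) s'(2)]
      \<comment> \<open>Both \<open>\<sigma> ` S\<close> and \<open>\<sigma> ` S'\<close> reorient the common image towards the root.\<close>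
      have "\<sigma> ` S = \<sigma> ` S'"
      proof (rule reversed_arcs_unique)
        show "wf_digraph (?G ?U)" using p(1) by (rule wf_digraph_restrict_arcs[OF wf_digraph_axioms])
        show "in_arborescence (reverse_arcs (\<sigma> ` S) (?G ?U)) r"
          using in_arborescence_reverse_replace_arcs[OF wf_digraph_axioms \<sigma> s(1-3)] .
        show "in_arborescence (reverse_arcs (\<sigma> ` S') (?G ?U)) r"
          unfolding eq using in_arborescence_reverse_replace_arcs[OF wf_digraph_axioms \<sigma> s'(1-3)] .
      qed (use p(2) p'(2) eq in simp_all)
      with p(4,5) p'(4,5) eq show "T = T' \<and> S = S'" by metis
    qed
    show "\<Phi> ` M = B"
    proof (intro equalityI subsetI)
      fix U assume "U \<in> \<Phi> ` M"
      then obtain T S where m: "(T, S) \<in> M" and U: "U = replace_arcs \<sigma> S T"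
        by (auto simp: \<Phi>_def)
      note s = sub[OF m]
      note p = replace_arcs_properties[OF wf_digraph_axioms \<sigma> s(1) s(4) s(2)]
      have "in_arborescence (reverse_arcs (\<sigma> ` S) (?G U)) r"
        unfolding U using in_arborescence_reverse_replace_arcs[OF wf_digraph_axioms \<sigma> s(1-3)] .
      with p s(5) show "U \<in> B" unfolding B_def U by blast
    next
      fix T assume "T \<in> B"
      then obtain S where s: "T \<subseteq> arcs G" "S \<subseteq> T" "card S = k"
          "in_arborescence (reverse_arcs S (?G T)) r"
        by (auto simp: B_def)
      then have "undirected_tree (?G T)"
        by (simp add: in_arborescence_def undirected_tree_reverse_arcs_iff)
      note p = replace_arcs_properties[OF wf_digraph_axioms \<sigma> s(1) this s(2)]
      have "(replace_arcs \<sigma> S T, \<sigma> ` S) \<in> M"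
        using in_arborescence_replace_arcs[OF wf_digraph_axioms \<sigma> s(1,2,4)] p s(3)
        by (simp add: M_def A_def)
      moreover have "\<Phi> (replace_arcs \<sigma> S T, \<sigma> ` S) = T" using p(5) by (simp add: \<Phi>_def)
      ultimately show "T \<in> \<Phi> ` M" by (metis image_eqI)
    qed
  qed
  then have "card B = card M" by (simp add: bij_betw_same_card)
  also have "\<dots> = (\<Sum>T\<in>A. card {S. S \<subseteq> T \<and> card S = k})"
  proof -
    have "finite A" unfolding A_def using finite_arcs by simp
    moreover have "finite {S. S \<subseteq> T \<and> card S = k}" if "T \<in> A" for T
      using that finite_subset[OF _ finite_arcs] by (auto simp: A_def)
    ultimately show ?thesis unfolding M_def by (intro card_SigmaI) auto
  qed
  also have "\<dots> = (\<Sum>T\<in>A. card (verts G) - 1 choose k)"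
  proof (rule sum.cong)
    fix T assume T: "T \<in> A"
    then have "finite T" using finite_subset[OF _ finite_arcs] by (auto simp: A_def)
    moreover have "card T = card (verts G) - 1"
      using card_arcs_in_arborescence[OF wf_digraph_restrict_arcs[OF wf_digraph_axioms], of T r] T
      by (simp add: A_def)
    ultimately show "card {S. S \<subseteq> T \<and> card S = k} = (card (verts G) - 1 choose k)"
      by (simp add: n_subsets)
  qed simp
  also have "\<dots> = card A * (card (verts G) - 1 choose k)" by simp
  finally have "card B = card A * (card (verts G) - 1 choose k)" .
  moreover have "{H. k_spanning_tree G r k H} = ?G ` B"
    unfolding k_spanning_tree_iff[OF wf_digraph_axioms] B_def by auto
  moreover have "inj_on ?G B"
  proof (rule inj_onI)
    fix T T' assume "?G T = ?G T'"
    then have "arcs (?G T) = arcs (?G T')" by simp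
    then show "T = T'" by simp
  qed
  ultimately show ?thesis
    unfolding num_k_spanning_trees_def A_def by (simp add: card_image)
qed

lemma ultra_log_concave_binomial:
  assumes "\<And>k. a k = c * (d choose k)"
  shows "ultra_log_concave d a"
  unfolding ultra_log_concave_def
proof (intro allI impI)
  fix k assume k: "0 < k \<and> k < d"
  have quot: "real (a m) / real (d choose m) = real c" if "m \<le> d" for m
    using that by (simp add: assms)
  have "(real (a k))\<^sup>2 / (real (d choose k))\<^sup>2 = real c * real c"
    using k quot[of k] by (metis less_imp_le power_divide power2_eq_square)
  moreover have "k + 1 \<le> d" "k - 1 \<le> d" using k by auto
  then have "real (a (k + 1)) / real (d choose (k + 1)) *
      (real (a (k - 1)) / real (d choose (k - 1))) = real c * real c"
    by (simp only: quot)
  ultimately show "(real (a k))\<^sup>2 / (real (d choose k))\<^sup>2 \<ge>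
      real (a (k + 1)) / real (d choose (k + 1)) * (real (a (k - 1)) / real (d choose (k - 1)))"
    by simp
qed

theorem proposition5p2:
  fixes G :: "(nat, 'b) pre_digraph" and n r :: nat
  assumes "eulerian G"
    and "verts G = {1..n}"
    and "\<And>i j. i \<in> {1..n} \<Longrightarrow> j \<in> {1..n} \<Longrightarrow>
           card {e \<in> arcs G. tail G e = i \<and> head G e = j} =
           card {e \<in> arcs G. tail G e = j \<and> head G e = i}"
    and "r \<in> verts G"
  shows "ultra_log_concave (card (verts G) - 1) (coeff (spanning_tree_poly G r))"
proof -
  have fin: "fin_digraph G" using assms(1) by (simp add: eulerian_def)
  obtain \<sigma> where "arc_reversal G \<sigma>"
    using arc_reversal_exists[OF fin] assms(2,3) by auto
  then show ?thesis
    by (intro ultra_log_concave_binomial, unfold coeff_spanning_tree_poly[OF fin])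
       (rule num_k_spanning_trees_eq[OF fin])
qed

end
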